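(* Any finite semigroup $S$ can be embedded in a finite semigroup $T=\langle\alpha,\beta\rangle$, where $\alpha$ is an idempotent and $\beta$ is a nilpotent element.
   Context: An embedding is an injective semigroup homomorphism. $\langle\alpha,\beta\rangle$ denotes the semigroup generated by $\alpha$ and $\beta$. An element $\beta$ of a semigroup with zero $0$ is nilpotent if $\beta^k=0$ for some $k\geq 1$ (in particular $T$ has a zero element). *)

theory Defs
  imports Main
begin

text \<open>
  Semigroups are given by an explicit carrier set and a binary operation, which is only
  constrained on the carrier. (The library locale \<open>semigroup\<close> is about operations on a whole
  type, which does not allow a semigroup to be asserted to exist.)
\<close>

definition semigroup_on :: "'a set \<Rightarrow> ('a \<Rightarrow> 'a \<Rightarrow> 'a) \<Rightarrow> bool" where
  "semigroup_on S f \<longleftrightarrow>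
     (\<forall>x\<in>S. \<forall>y\<in>S. f x y \<in> S) \<and>
     (\<forall>x\<in>S. \<forall>y\<in>S. \<forall>z\<in>S. f (f x y) z = f x (f y z))"

definition semigroup_embedding ::
  "'a set \<Rightarrow> ('a \<Rightarrow> 'a \<Rightarrow> 'a) \<Rightarrow> 'b set \<Rightarrow> ('b \<Rightarrow> 'b \<Rightarrow> 'b) \<Rightarrow> ('a \<Rightarrow> 'b) \<Rightarrow> bool" where
  "semigroup_embedding S f T g \<phi> \<longleftrightarrow>
     \<phi> ` S \<subseteq> T \<and> (\<forall>x\<in>S. \<forall>y\<in>S. \<phi> (f x y) = g (\<phi> x) (\<phi> y)) \<and> inj_on \<phi> S"

inductive_set generated_semigroup :: "('a \<Rightarrow> 'a \<Rightarrow> 'a) \<Rightarrow> 'a set \<Rightarrow> 'a set"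
  for f :: "'a \<Rightarrow> 'a \<Rightarrow> 'a" and X :: "'a set" where
  gen: "x \<in> X \<Longrightarrow> x \<in> generated_semigroup f X"
| mult: "x \<in> generated_semigroup f X \<Longrightarrow> y \<in> generated_semigroup f X \<Longrightarrow>
         f x y \<in> generated_semigroup f X"

definition idempotent_in :: "'a set \<Rightarrow> ('a \<Rightarrow> 'a \<Rightarrow> 'a) \<Rightarrow> 'a \<Rightarrow> bool" where
  "idempotent_in S f x \<longleftrightarrow> x \<in> S \<and> f x x = x"

definition zero_in :: "'a set \<Rightarrow> ('a \<Rightarrow> 'a \<Rightarrow> 'a) \<Rightarrow> 'a \<Rightarrow> bool" where
  "zero_in S f z \<longleftrightarrow> z \<in> S \<and> (\<forall>x\<in>S. f z x = z \<and> f x z = z)"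

text \<open>
  There need not be a unit, so powers are only meaningful for exponents at least 1;
  the value at exponent 0 is left unspecified.
\<close>

fun semigroup_power :: "('a \<Rightarrow> 'a \<Rightarrow> 'a) \<Rightarrow> 'a \<Rightarrow> nat \<Rightarrow> 'a" where
  "semigroup_power f x 0 = undefined"
| "semigroup_power f x (Suc 0) = x"
| "semigroup_power f x (Suc (Suc n)) = f x (semigroup_power f x (Suc n))"

definition nilpotent_in :: "'a set \<Rightarrow> ('a \<Rightarrow> 'a \<Rightarrow> 'a) \<Rightarrow> 'a \<Rightarrow> bool" where
  "nilpotent_in S f x \<longleftrightarrow>
     x \<in> S \<and> (\<exists>z. zero_in S f z \<and> (\<exists>k\<ge>1. semigroup_power f x k = z))"

end

(* Write S = {s_1, ..., s_n} and let s_0 = 1 be the identity of S^1. On the states (i, x) with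
   i <= n and x in S^1, together with a dead state, let \<alpha> send (i, x) to (0, s_i x) and let \<beta> send
   (i, x) to (i + 1, x), which is the dead state for i = n. Then \<alpha> is idempotent because s_0 = 1,
   \<beta>^(n+1) is the constant map to the dead state, and \<alpha> \<beta>^i \<alpha> sends (j, x) to (0, s_i s_j x), so that
   s_i \<mapsto> \<alpha> \<beta>^i \<alpha> is an embedding. *)
theory Submission
  imports Defs
begin

section \<open>Powers and generated semigroups\<close>

lemma semigroup_power_Suc:
  "k \<ge> 1 \<Longrightarrow> semigroup_power f x (Suc k) = f x (semigroup_power f x k)"
  by (cases k) auto

lemma semigroup_power_comp: "k \<ge> 1 \<Longrightarrow> semigroup_power (\<circ>) f k = f ^^ k"
  by (induction k rule: nat_induct_at_least) (auto simp: semigroup_power_Suc)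

lemma semigroup_power_in_generated:
  "x \<in> X \<Longrightarrow> k \<ge> 1 \<Longrightarrow> semigroup_power f x k \<in> generated_semigroup f X"
  by (rotate_tac, induction k rule: nat_induct_at_least)
    (auto simp: semigroup_power_Suc intro: generated_semigroup.intros)

lemma generated_semigroup_subset:
  assumes "X \<subseteq> A" and "\<And>x y. x \<in> A \<Longrightarrow> y \<in> A \<Longrightarrow> f x y \<in> A"
  shows "generated_semigroup f X \<subseteq> A"
proof
  show "x \<in> A" if "x \<in> generated_semigroup f X" for x
    using that by induction (use assms in auto)
qed

lemma semigroup_on_generated_comp: "semigroup_on (generated_semigroup (\<circ>) X) (\<circ>)"
  unfolding semigroup_on_def by (auto intro: generated_semigroup.mult simp: comp_assoc)

section \<open>Transport of structure along a homomorphism\<close>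

locale semigroup_hom =
  fixes T :: "'b set" and g :: "'b \<Rightarrow> 'b \<Rightarrow> 'b" and g' :: "'c \<Rightarrow> 'c \<Rightarrow> 'c" and h :: "'b \<Rightarrow> 'c"
  assumes semigroup: "semigroup_on T g"
    and hom: "\<And>x y. x \<in> T \<Longrightarrow> y \<in> T \<Longrightarrow> h (g x y) = g' (h x) (h y)"
begin

lemma closed: "x \<in> T \<Longrightarrow> y \<in> T \<Longrightarrow> g x y \<in> T"
  using semigroup by (simp add: semigroup_on_def)

lemma semigroup_on_image: "semigroup_on (h ` T) g'"
  using semigroup unfolding semigroup_on_def by (auto simp: hom[symmetric])

lemma generated_semigroup_image:
  assumes T: "T = generated_semigroup g X"
  shows "h ` T = generated_semigroup g' (h ` X)"
proof
  have "h x \<in> generated_semigroup g' (h ` X)" if "x \<in> generated_semigroup g X" for x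
    using that by induction (auto intro: generated_semigroup.intros simp: hom T)
  then show "h ` T \<subseteq> generated_semigroup g' (h ` X)"
    using T by auto
  show "generated_semigroup g' (h ` X) \<subseteq> h ` T"
  proof (rule generated_semigroup_subset)
    show "h ` X \<subseteq> h ` T"
      using T by (auto intro: generated_semigroup.gen)
    show "g' x y \<in> h ` T" if "x \<in> h ` T" "y \<in> h ` T" for x y
      using that closed by (auto simp: hom[symmetric])
  qed
qed

lemma idempotent_in_image: "idempotent_in T g x \<Longrightarrow> idempotent_in (h ` T) g' (h x)"
  unfolding idempotent_in_def by (metis hom imageI)

lemma zero_in_image: "zero_in T g z \<Longrightarrow> zero_in (h ` T) g' (h z)"
  unfolding zero_in_def by (auto simp: hom[symmetric])

lemma semigroup_power_image:
  assumes "k \<ge> 1" and x: "x \<in> T"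
  shows "semigroup_power g x k \<in> T \<and> h (semigroup_power g x k) = semigroup_power g' (h x) k"
  using assms(1)
  by (induction k rule: nat_induct_at_least) (use x in \<open>auto simp: semigroup_power_Suc closed hom\<close>)

lemma nilpotent_in_image: "nilpotent_in T g x \<Longrightarrow> nilpotent_in (h ` T) g' (h x)"
  unfolding nilpotent_in_def by (metis imageI semigroup_power_image zero_in_image)

lemma semigroup_embedding_comp:
  assumes "semigroup_embedding S f T g \<phi>" and "inj_on h T"
  shows "semigroup_embedding S f (h ` T) g' (h \<circ> \<phi>)"
  using assms unfolding semigroup_embedding_def
  by (auto simp: hom image_subset_iff intro: comp_inj_on inj_on_subset)

end

section \<open>The monoid S^1 and the two maps of states\<close>

fun option_mult :: "('a \<Rightarrow> 'a \<Rightarrow> 'a) \<Rightarrow> 'a option \<Rightarrow> 'a option \<Rightarrow> 'a option" where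
  "option_mult f None y = y"
| "option_mult f (Some a) None = Some a"
| "option_mult f (Some a) (Some b) = Some (f a b)"

type_synonym 'a state = "(nat \<times> 'a option) option"

locale enumerated_semigroup =
  fixes S :: "'a set" and f :: "'a \<Rightarrow> 'a \<Rightarrow> 'a" and e :: "nat \<Rightarrow> 'a" and n :: nat
  assumes semigroup: "semigroup_on S f" and enum: "bij_betw e {1..n} S"
begin

text \<open>\<open>None\<close> is a new identity even if S already has one. Hence left
  multiplication on S^1 is always faithful.\<close>

definition elt :: "nat \<Rightarrow> 'a option" where
  "elt i = (if i = 0 then None else Some (e i))"

abbreviation mult1 :: "'a option \<Rightarrow> 'a option \<Rightarrow> 'a option"  (infixl "\<odot>" 70) where
  "x \<odot> y \<equiv> option_mult f x y"

abbreviation S1 :: "'a option set" where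
  "S1 \<equiv> insert None (Some ` S)"

text \<open>The dead state is \<^term>\<open>None\<close>. Maps of states are forced to be dead outside
  \<open>live\<close>, because otherwise there would be infinitely many of them.\<close>

definition live :: "(nat \<times> 'a option) set" where
  "live = {..n} \<times> S1"

definition \<alpha> :: "'a state \<Rightarrow> 'a state" where
  "\<alpha> q = (case q of None \<Rightarrow> None
          | Some (i, x) \<Rightarrow> if (i, x) \<in> live then Some (0, elt i \<odot> x) else None)"

definition \<beta> :: "'a state \<Rightarrow> 'a state" where
  "\<beta> q = (case q of None \<Rightarrow> None
          | Some (i, x) \<Rightarrow> if (i, x) \<in> live \<and> i < n then Some (Suc i, x) else None)"

definition T :: "('a state \<Rightarrow> 'a state) set" where
  "T = generated_semigroup (\<circ>) {\<alpha>, \<beta>}"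

lemma enum_in: "1 \<le> i \<Longrightarrow> i \<le> n \<Longrightarrow> e i \<in> S"
  using enum by (auto dest: bij_betwE)

lemma elt_in: "i \<le> n \<Longrightarrow> elt i \<in> S1"
  by (simp add: elt_def enum_in)

lemma mult1_in: "x \<in> S1 \<Longrightarrow> y \<in> S1 \<Longrightarrow> x \<odot> y \<in> S1"
  using semigroup by (auto simp: semigroup_on_def)

lemma mult1_assoc: "x \<in> S1 \<Longrightarrow> y \<in> S1 \<Longrightarrow> z \<in> S1 \<Longrightarrow> x \<odot> y \<odot> z = x \<odot> (y \<odot> z)"
  using semigroup by (auto simp: semigroup_on_def)

lemma \<alpha>_live: "i \<le> n \<Longrightarrow> x \<in> S1 \<Longrightarrow> \<alpha> (Some (i, x)) = Some (0, elt i \<odot> x)"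
  by (simp add: \<alpha>_def live_def)

lemma \<alpha>_None [simp]: "\<alpha> None = None"
  by (simp add: \<alpha>_def)

lemma \<beta>_None [simp]: "\<beta> None = None"
  by (simp add: \<beta>_def)

lemma funpow_\<beta>_None [simp]: "(\<beta> ^^ k) None = None"
  by (induction k) auto

lemma funpow_\<beta>:
  "(i, x) \<in> live \<Longrightarrow> (\<beta> ^^ k) (Some (i, x)) = (if i + k \<le> n then Some (i + k, x) else None)"
  by (induction k) (auto simp: \<beta>_def live_def)

text \<open>A live state has index at most \<open>n\<close>, so \<open>n + 1\<close> increments kill
  it; any other state is dead after one step.\<close>

lemma funpow_\<beta>_dead: "(\<beta> ^^ Suc n) = (\<lambda>_. None)"
proof
  fix q
  show "(\<beta> ^^ Suc n) q = None"
  proof (cases "\<exists>i x. q = Some (i, x) \<and> (i, x) \<in> live")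
    case True
    then show ?thesis
      using funpow_\<beta>[of _ _ "Suc n"] by fastforce
  next
    case False
    then have "\<beta> q = None"
      by (auto simp: \<beta>_def split: option.split)
    then show ?thesis
      \<comment> \<open>One \<open>\<beta>\<close> is moved innermost, where it kills
        \<open>q\<close>; the others fix \<open>None\<close>.\<close>
      by (simp add: funpow_swap1)
  qed
qed

text \<open>Every element of \<open>T\<close> maps the finite set \<open>Q\<close> into itself and
  is constant outside \<open>Q\<close>, which leaves finitely many choices.\<close>

lemma finite_T:
  assumes "finite S"
  shows "finite T"
proof -
  define Q where "Q = insert None (Some ` live)"
  let ?F = "{u. \<forall>q. (q \<in> Q \<longrightarrow> u q \<in> Q) \<and> (q \<notin> Q \<longrightarrow> u q = None)}"
  \<comment> \<open>Fixing \<open>None\<close> makes the set closed under composition: outside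
    \<open>Q\<close> the inner map yields \<open>None\<close>, and the outer one must keep
    it.\<close>
  let ?G = "{u \<in> ?F. u None = None}"
  have "finite Q"
    using assms by (simp add: Q_def live_def)
  then have "finite ?F"
    by (rule finite_set_of_finite_funs[OF _ \<open>finite Q\<close>])
  then have "finite ?G"
    by (rule finite_subset[rotated]) blast
  moreover have "T \<subseteq> ?G"
    unfolding T_def
  proof (rule generated_semigroup_subset)
    have "Some (0, elt i \<odot> x) \<in> Q" if "(i, x) \<in> live" for i x
    proof -
      have "elt i \<odot> x \<in> S1"
        using that by (intro mult1_in elt_in) (auto simp: live_def)
      then show ?thesis
        unfolding Q_def live_def by blast
    qed
    then have "\<alpha> \<in> ?G"
      by (auto simp: \<alpha>_def Q_def split: option.split)
    moreover have "\<beta> \<in> ?G"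
      by (auto simp: \<beta>_def live_def Q_def split: option.split)
    ultimately show "{\<alpha>, \<beta>} \<subseteq> ?G"
      by (simp only: insert_subset empty_subsetI simp_thms)
    show "u \<circ> v \<in> ?G" if "u \<in> ?G" "v \<in> ?G" for u v
      using that by simp
  qed
  ultimately show ?thesis
    by (rule finite_subset[rotated])
qed

lemma \<alpha>_\<alpha>: "\<alpha> \<circ> \<alpha> = \<alpha>"
proof
  fix q
  show "(\<alpha> \<circ> \<alpha>) q = \<alpha> q"
  proof (cases "\<exists>i x. q = Some (i, x) \<and> (i, x) \<in> live")
    case True
    then obtain i x where "q = Some (i, x)" "i \<le> n" "x \<in> S1"
      unfolding live_def by blast
    then show ?thesis
      \<comment> \<open>The product stays in \<open>S1\<close>, so the intermediate state is live
        and the outer \<open>\<alpha>\<close> only multiplies by \<open>elt 0\<close>.\<close>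
      using mult1_in[OF elt_in[of i], of x] by (simp only: comp_apply \<alpha>_live) (simp add: elt_def)
  next
    case False
    then have "\<alpha> q = None"
      by (auto simp: \<alpha>_def split: option.split)
    then show ?thesis
      by simp
  qed
qed

lemma idempotent_in_\<alpha>: "idempotent_in T (\<circ>) \<alpha>"
  by (simp add: idempotent_in_def T_def \<alpha>_\<alpha> generated_semigroup.gen)

lemma funpow_\<beta>_in: "k \<ge> 1 \<Longrightarrow> \<beta> ^^ k \<in> T"
  using semigroup_power_in_generated[of \<beta> "{\<alpha>, \<beta>}" k "(\<circ>)"] by (simp add: semigroup_power_comp T_def)

text \<open>This makes the constant map to \<open>None\<close> absorb elements of \<open>T\<close>
  composed on its left; on its right it absorbs any map.\<close>

lemma T_None: "u \<in> T \<Longrightarrow> u None = None"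
  using generated_semigroup_subset[of "{\<alpha>, \<beta>}" "{u. u None = None}" "(\<circ>)"] by (auto simp: T_def)

lemma nilpotent_in_\<beta>: "nilpotent_in T (\<circ>) \<beta>"
proof -
  have "(\<lambda>_. None) \<in> T"
    \<comment> \<open>The zero must itself be generated; it is a power of
      \<open>\<beta>\<close>.\<close>
    using funpow_\<beta>_in[of "Suc n"] unfolding funpow_\<beta>_dead by simp
  then have "zero_in T (\<circ>) (\<lambda>_. None)"
    by (auto simp: zero_in_def T_None)
  moreover have "semigroup_power (\<circ>) \<beta> (Suc n) = (\<lambda>_. None)"
    using semigroup_power_comp[of "Suc n" \<beta>] funpow_\<beta>_dead by simp
  moreover have "\<beta> \<in> T"
    by (simp add: T_def generated_semigroup.gen)
  ultimately show ?thesis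
    unfolding nilpotent_in_def by (metis One_nat_def Suc_le_mono zero_le)
qed

section \<open>The embedding of S\<close>

definition act :: "'a \<Rightarrow> 'a state \<Rightarrow> 'a state" where
  "act a = \<alpha> \<circ> \<beta> ^^ inv_into {1..n} e a \<circ> \<alpha>"

lemma index:
  assumes "a \<in> S"
  obtains i where "inv_into {1..n} e a = i" "1 \<le> i" "i \<le> n" "e i = a"
  using assms enum
  by (metis atLeastAtMost_iff bij_betw_def bij_betw_inv_into_right inv_into_into)

lemma act_live:
  assumes a: "a \<in> S" and "i \<le> n" "x \<in> S1"
  shows "act a (Some (i, x)) = Some (0, Some a \<odot> (elt i \<odot> x))"
proof -
  obtain k where k: "inv_into {1..n} e a = k" "1 \<le> k" "k \<le> n" "e k = a"
    using index[OF a] .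
  have x: "elt i \<odot> x \<in> S1"
    using assms by (intro mult1_in elt_in)
  \<comment> \<open>Since \<open>k \<le> n\<close>, the state survives while its index counts from 0
    up to that of \<open>a\<close>.\<close>
  have "(\<beta> ^^ k) (Some (0, elt i \<odot> x)) = Some (k, elt i \<odot> x)"
    using funpow_\<beta>[of 0 "elt i \<odot> x" k] x k by (simp add: live_def)
  moreover have "elt k = Some a"
    using k by (simp add: elt_def)
  ultimately show ?thesis
    using k x assms by (simp only: act_def comp_apply \<alpha>_live)
qed

text \<open>\<open>act b\<close> leaves index 0, so the first \<open>\<alpha>\<close> of
  \<open>act a\<close> multiplies by the identity; associativity in S^1 does the rest.\<close>

lemma act_mult:
  assumes "a \<in> S" "b \<in> S"
  shows "act (f a b) = act a \<circ> act b"
proof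
  have ab: "f a b \<in> S"
    using assms semigroup by (simp add: semigroup_on_def)
  fix q
  show "act (f a b) q = (act a \<circ> act b) q"
  proof (cases "\<exists>i x. q = Some (i, x) \<and> (i, x) \<in> live")
    case True
    then obtain i x where q: "q = Some (i, x)" "i \<le> n" "x \<in> S1"
      unfolding live_def by blast
    define y where "y = elt i \<odot> x"
    have y: "y \<in> S1" "Some b \<odot> y \<in> S1"
      using mult1_in[OF elt_in[OF q(2)] q(3)] mult1_in[of "Some b" y] assms
      unfolding y_def by blast+
    have "(act a \<circ> act b) q = act a (Some (0, Some b \<odot> y))"
      using q assms by (simp only: comp_apply act_live y_def)
    also have "\<dots> = Some (0, Some a \<odot> (Some b \<odot> y))"
      using act_live[OF assms(1) _ y(2), of 0] by (simp add: elt_def)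
    also have "\<dots> = Some (0, Some (f a b) \<odot> y)"
      using mult1_assoc[of "Some a" "Some b" y] assms y by simp
    also have "\<dots> = act (f a b) q"
      using q ab by (simp only: act_live y_def)
    finally show ?thesis
      by simp
  next
    case False
    then have "\<alpha> q = None"
      by (auto simp: \<alpha>_def split: option.split)
    \<comment> \<open>Both sides apply \<open>\<alpha>\<close> first, and all later maps fix
      \<open>None\<close>.\<close>
    then show ?thesis
      by (simp add: act_def)
  qed
qed

lemma semigroup_embedding_act: "semigroup_embedding S f T (\<circ>) act"
  unfolding semigroup_embedding_def
proof (intro conjI ballI)
  have "act a \<in> T" if a: "a \<in> S" for a
  proof -
    have "\<alpha> \<in> T"
      by (simp add: T_def generated_semigroup.gen)
    \<comment> \<open>The enumeration starts at 1, so the middle factor is a proper power of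
      \<open>\<beta>\<close> and not the identity map.\<close>
    moreover obtain k where "inv_into {1..n} e a = k" "1 \<le> k"
      using index[OF a] .
    ultimately show ?thesis
      using funpow_\<beta>_in unfolding act_def T_def by (auto intro!: generated_semigroup.mult)
  qed
  then show "act ` S \<subseteq> T"
    by blast
  show "act (f a b) = act a \<circ> act b" if "a \<in> S" "b \<in> S" for a b
    using that by (rule act_mult)
  show "inj_on act S"
  proof (rule inj_onI)
    fix a b
    assume ab: "a \<in> S" "b \<in> S" and eq: "act a = act b"
    \<comment> \<open>Evaluation at the state (0, 1) recovers the element.\<close>
    have "act c (Some (0, None)) = Some (0, Some c)" if "c \<in> S" for c
      using act_live[OF that, of 0 None] by (simp add: elt_def)
    with ab eq show "a = b"
      by (metis Pair_inject option.inject)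
  qed
qed

end

theorem theorem1p1:
  fixes S :: "'a set" and f :: "'a \<Rightarrow> 'a \<Rightarrow> 'a"
  assumes "semigroup_on S f" and "finite S"
  shows "\<exists>(T :: nat set) (g :: nat \<Rightarrow> nat \<Rightarrow> nat) \<alpha> \<beta> \<phi>.
           semigroup_on T g \<and> finite T \<and>
           T = generated_semigroup g {\<alpha>, \<beta>} \<and>
           idempotent_in T g \<alpha> \<and> nilpotent_in T g \<beta> \<and>
           semigroup_embedding S f T g \<phi>"
proof -
  obtain e where "bij_betw e {1..card S} S"
    using ex_bij_betw_nat_finite_1[OF assms(2)] by blast
  then interpret enumerated_semigroup S f e "card S"
    using assms(1) by unfold_locales
  have fin: "finite T"
    using assms(2) by (rule finite_T)
  \<comment> \<open>The maps of states are renamed as natural numbers by an arbitrary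
    injection.\<close>
  then obtain h :: "('a state \<Rightarrow> 'a state) \<Rightarrow> nat" where h: "inj_on h T"
    using finite_imp_inj_to_nat_seg by blast
  \<comment> \<open>Composition carried over to codes: decode both, compose, encode.\<close>
  define g where "g i j = h (inv_into T h i \<circ> inv_into T h j)" for i j
  interpret hom: semigroup_hom T "(\<circ>)" g h
  proof
    show "semigroup_on T (\<circ>)"
      unfolding T_def by (rule semigroup_on_generated_comp)
    show "h (u \<circ> v) = g (h u) (h v)" if "u \<in> T" "v \<in> T" for u v
      using that h by (simp add: g_def)
  qed
  have "h ` T = generated_semigroup g {h \<alpha>, h \<beta>}"
    using hom.generated_semigroup_image[OF T_def] by simp
  moreover have "semigroup_embedding S f (h ` T) g (h \<circ> act)"
    using semigroup_embedding_act h by (rule hom.semigroup_embedding_comp)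
  ultimately show ?thesis
    using hom.semigroup_on_image fin hom.idempotent_in_image[OF idempotent_in_\<alpha>]
      hom.nilpotent_in_image[OF nilpotent_in_\<beta>] by blast
qed

end
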